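(* Let $n\ge 3$ be an integer, $0<m<\frac{n-2}{n}$, $\rho_1>0$, $\eta>0$, $\beta>\frac{m\rho_1}{n-2-nm}$ and $\alpha=\frac{2\beta+\rho_1}{1-m}$. Let $f\in C^2((0,\infty))$, regarded as the radially symmetric function $f(x)=f(|x|)$ on $\mathbb{R}^n\setminus\{0\}$, be the unique radially symmetric solution of $$\Delta\left(\frac{f^m}{m}\right)+\alpha f+\beta x\cdot\nabla f=0,\qquad f>0,\qquad\text{in }\mathbb{R}^n\setminus\{0\}$$ that satisfies $\lim_{r\to 0^+}r^{\alpha/\beta}f(r)=\eta$. Then $$\lim_{|x|\to\infty}|x|^2f(x)^{1-m}=\frac{2(n-2-nm)}{(1-m)\rho_1}.$$
   Context: In radial form the equation reads $(f^m/m)_{rr}+\frac{n-1}{r}(f^m/m)_r+\alpha f+\beta r f_r=0$, $f>0$, for $r=|x|\in(0,\infty)$. Under the stated hypotheses a solution in $C^2((0,\infty))$ with the prescribed limit at the origin exists and is unique. *)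

theory Defs
  imports "HOL-Analysis.Analysis"
begin

text \<open>Meant for open sets: the derivatives are two-sided.\<close>

definition C2_on :: "(real \<Rightarrow> real) \<Rightarrow> real set \<Rightarrow> bool" where
  "C2_on f S \<longleftrightarrow>
     (\<forall>r\<in>S. f differentiable (at r)) \<and>
     (\<forall>r\<in>S. deriv f differentiable (at r)) \<and>
     continuous_on S (deriv (deriv f))"

definition partial_deriv :: "'a::euclidean_space \<Rightarrow> ('a \<Rightarrow> real) \<Rightarrow> 'a \<Rightarrow> real" where
  "partial_deriv b u x = deriv (\<lambda>t. u (x + t *\<^sub>R b)) 0"

text \<open>Both operators below depend only on the values of the function near the point. They carry
  their usual meaning where the function is (twice) differentiable and are unspecified elsewhere.\<close>

definition gradient :: "('a::euclidean_space \<Rightarrow> real) \<Rightarrow> 'a \<Rightarrow> 'a" where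
  "gradient u x = (THE D. GDERIV u x :> D)"

definition laplacian :: "('a::euclidean_space \<Rightarrow> real) \<Rightarrow> 'a \<Rightarrow> real" where
  "laplacian u x = (\<Sum>b\<in>Basis. partial_deriv b (partial_deriv b u) x)"

end

theory Submission
  imports Defs
begin

text \<open>
  Let \<open>s = ln r\<close>, \<open>\<kappa> = \<alpha> / \<beta>\<close>, and follow along \<open>s\<close> the two quantities
  \<open>x = d/ds ln (r powr \<kappa> * f)\<close> and \<open>w = r\<^sup>2 * f powr (1 - m)\<close>. The radial equation becomes the
  autonomous quadratic system

    \<open>x' = \<gamma> - (m x + e + \<beta> w) x\<close>,   \<open>w' = (1 - m) (x - x\<^sub>0) w\<close>,

  where \<open>x\<^sub>0 = \<rho>\<^sub>1 / ((1 - m) \<beta>)\<close>, \<open>e = n - 2 - 2 m \<kappa>\<close> and \<open>\<gamma> = \<kappa> (n - 2 - m \<kappa>)\<close>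
  (lemmas \<open>radial_profile_equation\<close> and \<open>radial_equation_logarithmic_variables\<close>). The
  lower bound on \<open>\<beta>\<close> says that \<open>\<gamma> > 0\<close>. The only equilibrium with \<open>x > 0\<close> and \<open>w > 0\<close> is
  \<open>(x\<^sub>0, w\<^sub>0)\<close>, where \<open>w\<^sub>0\<close> is the asserted limit, so the claim is that \<open>w\<close> tends to \<open>w\<^sub>0\<close> as
  \<open>s\<close> tends to infinity.

  The behaviour of \<open>f\<close> at the origin puts the orbit into the half-plane \<open>x > 0\<close>. Indeed, as
  \<open>s\<close> tends to minus infinity, \<open>w\<close> tends to infinity while \<open>ln (r powr \<kappa> * f)\<close>, whose slope is
  \<open>x\<close>, converges. This excludes that \<open>x \<le> 0\<close> for all \<open>s\<close>, and \<open>\<gamma> > 0\<close> makes the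
  half-plane forward invariant (lemma \<open>log_slope_becomes_positive\<close>).

  In \<open>x > 0\<close> the first equation can be written
  \<open>x' = - (x - x\<^sub>0) (m x + \<gamma> / x\<^sub>0) - \<beta> x (w - w\<^sub>0)\<close>. Without its first summand, the system is
  a Lotka--Volterra system in the variables \<open>ln x\<close> and \<open>ln w\<close>, with its well-known conserved
  quantity; the first summand is a damping for this quantity. So there is a global Lyapunov
  function, and the orbit converges to the equilibrium whatever the sign of the linear
  coefficient \<open>e\<close> (lemma \<open>damped_lotka_volterra_converges\<close>).
\<close>

section \<open>Radial functions\<close>

lemma norm_along_line_has_derivative:
  fixes x b :: "'a::euclidean_space"
  assumes "x \<noteq> 0"
  shows "((\<lambda>t. norm (x + t *\<^sub>R b)) has_real_derivative (x \<bullet> b) / norm x) (at 0)"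
proof -
  have "((\<lambda>t. sqrt (x \<bullet> x + 2 * t * (x \<bullet> b) + t * t * (b \<bullet> b))) has_real_derivative
      (x \<bullet> b) / norm x) (at 0)"
    using assms
    by (auto intro!: derivative_eq_intros simp: norm_eq_sqrt_inner field_simps simp flip: not_le)
  moreover have "norm (x + t *\<^sub>R b) = sqrt (x \<bullet> x + 2 * t * (x \<bullet> b) + t * t * (b \<bullet> b))" for t
    by (simp add: norm_eq_sqrt_inner algebra_simps inner_commute)
  ultimately show ?thesis by simp
qed

lemma partial_deriv_radial:
  fixes x b :: "'a::euclidean_space"
  assumes "x \<noteq> 0" "(U has_real_derivative U') (at (norm x))"
  shows "partial_deriv b (\<lambda>y. U (norm y)) x = U' * ((x \<bullet> b) / norm x)"
proof -
  have "((\<lambda>t. U (norm (x + t *\<^sub>R b))) has_real_derivative U' * ((x \<bullet> b) / norm x)) (at 0)"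
    using DERIV_chain2[OF _ norm_along_line_has_derivative[OF assms(1), of b], of U U'] assms(2)
    by simp
  then show ?thesis unfolding partial_deriv_def by (rule DERIV_imp_deriv)
qed

text \<open>
  Along a coordinate direction \<open>b\<close> the second derivative of a radial function at \<open>x\<close>, with
  \<open>r = |x|\<close>, is \<open>(U''/r\<^sup>2 - U'/r\<^sup>3) (x \<bullet> b)\<^sup>2 + U'/r\<close>; the squares \<open>(x \<bullet> b)\<^sup>2\<close> add up
  to \<open>r\<^sup>2\<close>.
\<close>

lemma laplacian_radial:
  fixes x :: "'a::euclidean_space"
  assumes "x \<noteq> 0"
    and U: "\<And>r. r > 0 \<Longrightarrow> (U has_real_derivative U' r) (at r)"
    and U': "(U' has_real_derivative U'') (at (norm x))"
  shows "laplacian (\<lambda>y. U (norm y)) x = U'' + (real DIM('a) - 1) / norm x * U' (norm x)"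
proof -
  define r where "r = norm x"
  have r: "r > 0" using assms(1) by (simp add: r_def)
  have second: "partial_deriv b (partial_deriv b (\<lambda>y. U (norm y))) x
      = (U'' / r\<^sup>2 - U' r / r ^ 3) * (x \<bullet> b)\<^sup>2 + U' r / r" if b: "b \<in> Basis" for b
  proof -
    let ?N = "\<lambda>t. norm (x + t *\<^sub>R b)"
    have N: "(?N has_real_derivative (x \<bullet> b) / r) (at 0)"
      using norm_along_line_has_derivative[OF assms(1)] by (simp add: r_def)
    have UN: "((\<lambda>t. U' (?N t)) has_real_derivative U'' * ((x \<bullet> b) / r)) (at 0)"
      using DERIV_chain2[OF _ N, of U' U''] U' by simp
    have D: "((\<lambda>t. U' (?N t) * ((x \<bullet> b + t) / ?N t)) has_real_derivative
        (U'' / r\<^sup>2 - U' r / r ^ 3) * (x \<bullet> b)\<^sup>2 + U' r / r) (at 0)"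
      using r by (auto intro!: derivative_eq_intros UN N simp: r_def[symmetric])
        (simp add: field_simps power2_eq_square power3_eq_cube)
    have "eventually (\<lambda>t. ?N t \<noteq> 0) (nhds 0)"
    proof -
      have "isCont ?N 0" using N by (rule DERIV_isCont)
      then have "(?N \<longlongrightarrow> ?N 0) (nhds 0)"
        by (simp only: isCont_def tendsto_at_iff_tendsto_nhds[of ?N])
      then show ?thesis using assms(1) by (intro tendsto_imp_eventually_ne) auto
    qed
    then have "eventually (\<lambda>t. partial_deriv b (\<lambda>y. U (norm y)) (x + t *\<^sub>R b)
        = U' (?N t) * ((x \<bullet> b + t) / ?N t)) (nhds 0)"
    proof eventually_elim
      case (elim t)
      then have "partial_deriv b (\<lambda>y. U (norm y)) (x + t *\<^sub>R b)
          = U' (?N t) * (((x + t *\<^sub>R b) \<bullet> b) / ?N t)"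
        by (intro partial_deriv_radial U) auto
      then show ?case using b by (simp add: inner_add_left)
    qed
    then show ?thesis
      unfolding partial_deriv_def[of b "partial_deriv b _"]
      using DERIV_imp_deriv[OF D] by (simp add: deriv_cong_ev)
  qed
  have "(\<Sum>b\<in>Basis. (x \<bullet> b)\<^sup>2) = r\<^sup>2"
    unfolding r_def power2_norm_eq_inner euclidean_inner[of x x] by (simp add: power2_eq_square)
  then have "laplacian (\<lambda>y. U (norm y)) x
      = (U'' / r\<^sup>2 - U' r / r ^ 3) * r\<^sup>2 + real DIM('a) * (U' r / r)"
    unfolding laplacian_def by (simp add: second sum.distrib flip: sum_distrib_left)
  also have "\<dots> = U'' + (real DIM('a) - 1) / r * U' r"
    using r by (simp add: field_simps power2_eq_square power3_eq_cube)
  finally show ?thesis unfolding r_def .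
qed

lemma inner_gradient_radial:
  fixes x :: "'a::euclidean_space"
  assumes "x \<noteq> 0" "(U has_real_derivative U') (at (norm x))"
  shows "x \<bullet> gradient (\<lambda>y. U (norm y)) x = norm x * U'"
proof -
  have "GDERIV norm x :> sgn x"
    using has_derivative_norm[OF assms(1)] by (simp add: gderiv_def inner_commute)
  then have "GDERIV (\<lambda>y. U (norm y)) x :> U' *\<^sub>R sgn x"
    using assms(2) by (rule GDERIV_DERIV_compose)
  moreover from this have "D = U' *\<^sub>R sgn x" if "GDERIV (\<lambda>y. U (norm y)) x :> D" for D
  proof -
    have "(\<lambda>h. h \<bullet> D) = (\<lambda>h. h \<bullet> (U' *\<^sub>R sgn x))"
      using that calculation unfolding gderiv_def by (rule has_derivative_unique)
    then show ?thesis by (metis inner_commute vector_eq_rdot)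
  qed
  ultimately have "gradient (\<lambda>y. U (norm y)) x = U' *\<^sub>R sgn x"
    unfolding gradient_def by blast
  then show ?thesis using assms(1)
    by (simp add: sgn_div_norm power2_norm_eq_inner[symmetric] power2_eq_square)
qed

text \<open>
  One point on each sphere is enough to read off the equation for the radial profile.
\<close>

lemma radial_profile_equation:
  fixes f f' f'' :: "real \<Rightarrow> real"
  assumes "m > 0" "r > 0"
    and f: "\<And>r. r > 0 \<Longrightarrow> (f has_real_derivative f' r) (at r)"
    and f': "\<And>r. r > 0 \<Longrightarrow> (f' has_real_derivative f'' r) (at r)"
    and pos: "\<And>r. r > 0 \<Longrightarrow> f r > 0"
    and eq: "\<And>x :: 'a::euclidean_space. x \<noteq> 0 \<Longrightarrow>
           laplacian (\<lambda>y :: 'a. f (norm y) powr m / m) x + \<alpha> * f (norm x)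
             + \<beta> * (x \<bullet> gradient (\<lambda>y :: 'a. f (norm y)) x) = 0"
  shows "(m - 1) * f r powr (m - 2) * (f' r)\<^sup>2 + f r powr (m - 1) * f'' r
      + (real DIM('a) - 1) / r * (f r powr (m - 1) * f' r) + \<alpha> * f r + \<beta> * (r * f' r) = 0"
proof -
  obtain x :: 'a where "norm x = r" using vector_choose_size[of r] assms(2) by auto
  then have "x \<noteq> 0" using assms(2) by auto
  have D1: "((\<lambda>r. f r powr m / m) has_real_derivative f r powr (m - 1) * f' r) (at r)"
    if "r > 0" for r
    using pos[OF that] assms(1) by (auto intro!: derivative_eq_intros f that)
  have D2: "((\<lambda>r. f r powr (m - 1) * f' r) has_real_derivative
      (m - 1) * f r powr (m - 2) * (f' r)\<^sup>2 + f r powr (m - 1) * f'' r) (at (norm x))"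
    using pos[OF assms(2)] \<open>norm x = r\<close> assms(2)
    by (auto intro!: derivative_eq_intros f f' simp: power2_eq_square)
  show ?thesis
    using eq[OF \<open>x \<noteq> 0\<close>] laplacian_radial[OF \<open>x \<noteq> 0\<close> D1 D2]
      inner_gradient_radial[OF \<open>x \<noteq> 0\<close> f] \<open>norm x = r\<close> assms(2) by simp
qed

section \<open>The planar system in logarithmic variables\<close>

text \<open>
  With \<open>s = ln r\<close> and \<open>q = r f' / f\<close>, multiplication of the radial equation by
  \<open>r\<^sup>2 f powr (-m)\<close> expresses \<open>r\<^sup>2 f'' / f\<close> as a polynomial in \<open>q\<close> and \<open>w\<close>. The shift
  \<open>x = q + \<kappa>\<close> with \<open>\<alpha> = \<beta> \<kappa>\<close> gives the coefficient of \<open>w\<close> the factor \<open>x\<close>.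
\<close>

lemma radial_equation_logarithmic_variables:
  fixes f f' f'' u x w :: "real \<Rightarrow> real" and N m \<alpha> \<beta> \<kappa> :: real
  assumes f: "\<And>r. r > 0 \<Longrightarrow> (f has_real_derivative f' r) (at r)"
    and f': "\<And>r. r > 0 \<Longrightarrow> (f' has_real_derivative f'' r) (at r)"
    and pos: "\<And>r. r > 0 \<Longrightarrow> f r > 0"
    and eq: "\<And>r. r > 0 \<Longrightarrow> (m - 1) * f r powr (m - 2) * (f' r)\<^sup>2 + f r powr (m - 1) * f'' r
              + (N - 1) / r * (f r powr (m - 1) * f' r) + \<alpha> * f r + \<beta> * (r * f' r) = 0"
    and "\<alpha> = \<beta> * \<kappa>"
  defines "u \<equiv> \<lambda>s. ln (f (exp s)) + \<kappa> * s"
    and "x \<equiv> \<lambda>s. exp s * f' (exp s) / f (exp s) + \<kappa>"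
    and "w \<equiv> \<lambda>s. (exp s)\<^sup>2 * f (exp s) powr (1 - m)"
  shows "(u has_real_derivative x s) (at s)"
    and "(x has_real_derivative
           \<kappa> * (N - 2 - m * \<kappa>) - (m * x s + (N - 2 - 2 * m * \<kappa>) + \<beta> * w s) * x s) (at s)"
    and "(w has_real_derivative (2 + (1 - m) * (x s - \<kappa>)) * w s) (at s)"
proof -
  define r where "r = exp s"
  define P where "P = f r powr m"
  have r: "r > 0" by (simp add: r_def)
  have F: "f r > 0" using pos r .
  have P: "P > 0" using F by (simp add: P_def)
  have powers: "f r powr (m - 1) = P / f r" "f r powr (m - 2) = P / (f r)\<^sup>2"
    "f r powr (1 - m) = f r / P"
    using F by (simp_all add: P_def powr_diff powr_numeral)
  note chain = DERIV_chain2[OF f[OF r, unfolded r_def] DERIV_exp]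
    DERIV_chain2[OF f'[OF r, unfolded r_def] DERIV_exp]
  show "(u has_real_derivative x s) (at s)"
    unfolding u_def x_def using F
    by (auto intro!: derivative_eq_intros chain simp: r_def)
  have "(x has_real_derivative
      r * f' r / f r + r\<^sup>2 * f'' r / f r - (r * f' r / f r)\<^sup>2) (at s)"
    unfolding x_def using F
    by (auto intro!: derivative_eq_intros chain simp: r_def)
      (simp add: field_simps power2_eq_square)
  moreover have "r * f' r / f r + r\<^sup>2 * f'' r / f r - (r * f' r / f r)\<^sup>2
      = \<kappa> * (N - 2 - m * \<kappa>) - (m * x s + (N - 2 - 2 * m * \<kappa>) + \<beta> * w s) * x s"
  proof -
    define q where "q = r * f' r / f r"
    define T where "T = r\<^sup>2 * f'' r / f r"
    have x: "x s = q + \<kappa>" by (simp add: x_def q_def r_def)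
    have w: "w s = r\<^sup>2 * (f r / P)" by (simp add: w_def powers flip: r_def)
    have "r\<^sup>2 / P * ((m - 1) * (P / (f r)\<^sup>2) * (f' r)\<^sup>2 + P / f r * f'' r
        + (N - 1) / r * (P / f r * f' r) + \<alpha> * f r + \<beta> * (r * f' r)) = 0"
      using eq[OF r] unfolding powers by simp
    also have "r\<^sup>2 / P * ((m - 1) * (P / (f r)\<^sup>2) * (f' r)\<^sup>2 + P / f r * f'' r
        + (N - 1) / r * (P / f r * f' r) + \<alpha> * f r + \<beta> * (r * f' r))
        = (m - 1) * q\<^sup>2 + T + (N - 1) * q + w s * (\<alpha> + \<beta> * q)"
      unfolding q_def T_def w using r P F by (simp add: field_simps power2_eq_square)
    finally have T: "T = - ((m - 1) * q\<^sup>2 + (N - 1) * q + w s * (\<alpha> + \<beta> * q))" by linarith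
    have "q + T - q\<^sup>2
      = \<kappa> * (N - 2 - m * \<kappa>) - (m * x s + (N - 2 - 2 * m * \<kappa>) + \<beta> * w s) * x s"
      unfolding T x assms(5) by (simp add: algebra_simps power2_eq_square)
    then show ?thesis unfolding q_def T_def .
  qed
  ultimately show "(x has_real_derivative \<kappa> * (N - 2 - m * \<kappa>)
      - (m * x s + (N - 2 - 2 * m * \<kappa>) + \<beta> * w s) * x s) (at s)" by simp
  show "(w has_real_derivative (2 + (1 - m) * (x s - \<kappa>)) * w s) (at s)"
    unfolding w_def x_def using F
    by (auto intro!: derivative_eq_intros chain simp: r_def)
      (simp add: powr_diff powr_minus field_simps power2_eq_square)
qed

section \<open>Entrance into the half-plane of positive slopes\<close>

text \<open>
  At the first time at which \<open>x\<close> came down to the level \<open>c\<close> its derivative would be positive, so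
  it would already have been below \<open>c\<close> slightly earlier.
\<close>

lemma barrier_from_below:
  fixes x x' :: "real \<Rightarrow> real"
  assumes start: "x a > c"
    and deriv: "\<And>s. a \<le> s \<Longrightarrow> s \<le> b \<Longrightarrow> (x has_real_derivative x' s) (at s)"
    and up: "\<And>s. a \<le> s \<Longrightarrow> s \<le> b \<Longrightarrow> x s = c \<Longrightarrow> x' s > 0"
    and s: "a \<le> s" "s \<le> b"
  shows "x s > c"
proof (rule ccontr)
  assume "\<not> x s > c"
  have cont: "continuous_on {a..s} x"
    using deriv s by (intro DERIV_continuous_on[of _ _ x'])
      (auto intro: has_field_derivative_at_within)
  define Z where "Z = {a..s} \<inter> x -` {c}"
  have "\<exists>t. a \<le> t \<and> t \<le> s \<and> x t = c"
    using \<open>\<not> x s > c\<close> start s(1) cont by (intro IVT2') auto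
  then have "Z \<noteq> {}" by (auto simp: Z_def)
  have "closed Z" unfolding Z_def using cont by (intro continuous_closed_preimage) auto
  then have "compact Z"
    using bounded_subset[OF bounded_closed_interval[of a s], of Z]
    by (auto simp: compact_eq_bounded_closed Z_def)
  then obtain t where t: "t \<in> Z" and first: "\<And>z. z \<in> Z \<Longrightarrow> t \<le> z"
    using compact_attains_inf[OF _ \<open>Z \<noteq> {}\<close>] by blast
  have at: "a < t" "t \<le> s" "x t = c" using t start by (auto simp: Z_def less_le)
  have "x' t > 0" using up at s by simp
  moreover have "(x has_real_derivative x' t) (at t)" using deriv at s by simp
  ultimately obtain d where d: "d > 0" "\<And>h. 0 < h \<Longrightarrow> h < d \<Longrightarrow> x (t - h) < x t"
    using DERIV_pos_inc_left by blast
  define h where "h = min (d / 2) (t - a)"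
  have h: "0 < h" "h < d" "a \<le> t - h" using d(1) at by (auto simp: h_def min_def)
  have "\<exists>z. a \<le> z \<and> z \<le> t - h \<and> x z = c"
    using d(2)[OF h(1,2)] start at h
    by (intro IVT2' continuous_on_subset[OF cont]) auto
  then obtain z where "z \<in> Z" "z < t" using at h by (auto simp: Z_def)
  then show False using first by force
qed

text \<open>
  Suppose that \<open>x \<le> 0\<close> throughout. The convergence of \<open>u\<close> gives, by the mean value theorem,
  arbitrarily early times at which \<open>x > -1\<close>. Since \<open>w\<close> is large at early times, the coefficient
  \<open>m x + e + \<beta> w\<close> is nonnegative there, so \<open>x\<close> increases at least at rate \<open>\<gamma>\<close> while it is in
  \<open>[-1, 0]\<close>, and it is positive before \<open>w\<close> ceases to be large. Once positive, \<open>x\<close> remains so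
  because its derivative at a zero is \<open>\<gamma>\<close>.
\<close>

lemma log_slope_becomes_positive:
  fixes u x w :: "real \<Rightarrow> real"
  assumes "\<gamma> > 0" "\<beta> > 0"
    and u: "\<And>s. (u has_real_derivative x s) (at s)"
    and x: "\<And>s. (x has_real_derivative \<gamma> - (m * x s + e + \<beta> * w s) * x s) (at s)"
    and w: "filterlim w at_top at_bot"
    and lim: "(u \<longlongrightarrow> l) at_bot"
  shows "\<exists>S. \<forall>s\<ge>S. x s > 0"
proof -
  have "\<exists>S. x S > 0"
  proof (rule ccontr)
    assume "\<nexists>S. x S > 0"
    then have nonpos: "x s \<le> 0" for s by (simp add: not_less)
    have "eventually (\<lambda>s. w s \<ge> (\<bar>m\<bar> + \<bar>e\<bar>) / \<beta>) at_bot"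
      using w by (simp add: filterlim_at_top)
    then obtain S where S: "w s \<ge> (\<bar>m\<bar> + \<bar>e\<bar>) / \<beta>" if "s \<le> S" for s
      by (auto simp: eventually_at_bot_linorder)
    \<comment> \<open>The bound on \<open>w\<close> dominates \<open>m x + e\<close> only for \<open>|x| \<le> 1\<close>, hence the lower level \<open>-1\<close>.\<close>
    have rate: "\<gamma> - (m * x s + e + \<beta> * w s) * x s \<ge> \<gamma>" if "s \<le> S" "x s \<ge> -1" for s
    proof -
      have "\<bar>m * x s\<bar> \<le> \<bar>m\<bar>"
        using that(2) nonpos[of s] mult_left_mono[of "\<bar>x s\<bar>" 1 "\<bar>m\<bar>"]
        by (simp add: abs_mult)
      moreover have "\<beta> * w s \<ge> \<bar>m\<bar> + \<bar>e\<bar>"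
        using S[OF that(1)] assms(2) by (simp add: field_simps)
      ultimately have "m * x s + e + \<beta> * w s \<ge> 0" by linarith
      then show ?thesis using nonpos[of s] by (simp add: mult_nonneg_nonpos)
    qed
    have "eventually (\<lambda>s. dist (u s) l < 1 / 2) at_bot"
      using lim by (rule tendstoD) simp
    then obtain T where T: "dist (u s) l < 1 / 2" if "s \<le> T" for s
      by (auto simp: eventually_at_bot_linorder)
    \<comment> \<open>Early enough that \<open>u\<close> varies by less than 1 on \<open>[b - 1, b]\<close> and that the time left until
      \<open>S\<close> suffices to climb from \<open>-1\<close> to \<open>0\<close> at rate \<open>\<gamma>\<close>.\<close>
    define b where "b = min T (S - 1 / \<gamma> - 1)"
    obtain t where t: "b - 1 < t" "t < b" "u b - u (b - 1) = (b - (b - 1)) * x t"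
      using MVT2[of "b - 1" b u x] u by auto
    have "x t > -1"
    proof -
      have "b \<le> T" by (simp add: b_def)
      then show ?thesis
        using t(3) T[of b] T[of "b - 1"] by (simp add: dist_real_def abs_if split: if_splits)
    qed
    have tS: "t + 1 / \<gamma> + 1 < S" using t(2) by (auto simp: b_def)
    then have "t < S" using assms(1) by (smt (verit) divide_pos_pos)
    have above: "x s > -1" if "t \<le> s" "s \<le> S" for s
      using \<open>x t > -1\<close> x _ that
    proof (rule barrier_from_below[where b = S])
      fix s assume "s \<le> S" "x s = -1"
      then show "\<gamma> - (m * x s + e + \<beta> * w s) * x s > 0" using rate[of s] assms(1) by simp
    qed
    obtain z where z: "t < z" "z < S"
      "x S - x t = (S - t) * (\<gamma> - (m * x z + e + \<beta> * w z) * x z)"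
      using MVT2[OF \<open>t < S\<close> x] by blast
    have "(S - t) * (\<gamma> - (m * x z + e + \<beta> * w z) * x z) \<ge> (S - t) * \<gamma>"
      using rate[of z] above[of z] z \<open>t < S\<close> by (intro mult_left_mono) auto
    moreover have "(S - t) * \<gamma> > (1 / \<gamma> + 1) * \<gamma>"
      using tS assms(1) by (intro mult_strict_right_mono) auto
    then have "(S - t) * \<gamma> > 1" using assms(1) by (simp add: algebra_simps)
    ultimately show False using z(3) \<open>x t > -1\<close> nonpos[of S] by linarith
  qed
  then obtain S where S: "x S > 0" by blast
  have "x s > 0" if "s \<ge> S" for s
    using S x _ that order.refl
    by (rule barrier_from_below[where b = s]) (use assms(1) in simp)
  then show ?thesis by blast
qed

section \<open>Relative entropy\<close>

text \<open>
  The Bregman divergence of \<open>t\<close> from \<open>a\<close> for the convex function \<open>- a ln\<close>: the conserved quantity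
  of the Lotka--Volterra system is a sum of such terms. For \<open>a > 0\<close>, as a function of \<open>t > 0\<close>
  it vanishes exactly at \<open>a\<close> and tends to infinity at both ends of the half-line.
\<close>

definition rel_entropy :: "real \<Rightarrow> real \<Rightarrow> real" where
  "rel_entropy a t = t - a - a * ln (t / a)"

lemma rel_entropy_has_derivative:
  assumes "a > 0" "t > 0"
  shows "(rel_entropy a has_real_derivative 1 - a / t) (at t)"
  unfolding rel_entropy_def[abs_def]
  using assms by (auto intro!: derivative_eq_intros simp: field_simps)

text \<open>
  Applying \<open>ln y \<le> y - 1\<close> to \<open>y = sqrt (t / a)\<close>, instead of \<open>t / a\<close>, leaves a perfect square.
  The bound controls \<open>t\<close> from above and shows that small entropy forces \<open>t\<close> close to \<open>a\<close>.
\<close>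

lemma rel_entropy_ge:
  assumes "a > 0" "t > 0"
  shows "(sqrt t - sqrt a)\<^sup>2 \<le> rel_entropy a t"
proof -
  have "ln (t / a) = 2 * ln (sqrt (t / a))" using assms by (simp add: ln_sqrt)
  also have "\<dots> \<le> 2 * (sqrt (t / a) - 1)"
    using assms ln_le_minus_one[of "sqrt (t / a)"] by simp
  finally have "a * ln (t / a) \<le> a * (2 * (sqrt (t / a) - 1))" using assms by simp
  also have "a * sqrt (t / a) = sqrt a * sqrt t"
    using assms by (simp add: real_sqrt_divide field_simps)
  then have "a * (2 * (sqrt (t / a) - 1)) = 2 * (sqrt a * sqrt t) - 2 * a"
    by (simp add: algebra_simps)
  finally show ?thesis
    using assms by (simp add: rel_entropy_def power2_diff mult.commute)
qed

lemma rel_entropy_nonneg: "a > 0 \<Longrightarrow> t > 0 \<Longrightarrow> rel_entropy a t \<ge> 0"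
  using rel_entropy_ge[of a t] by (meson order_trans zero_le_power2)

text \<open>
  This is \<open>ln y \<le> y - 1\<close> at \<open>y = a / t\<close>. Together with the bounds on sublevel sets it compares the
  entropy with the squared distance to the equilibrium.
\<close>

lemma rel_entropy_le:
  assumes "a > 0" "t > 0"
  shows "rel_entropy a t \<le> (t - a)\<^sup>2 / t"
proof -
  have "- ln (t / a) \<le> a / t - 1"
    using ln_le_minus_one[of "a / t"] assms by (simp add: ln_div)
  then have "a * (- ln (t / a)) \<le> a * (a / t - 1)" using assms by (intro mult_left_mono) auto
  then have "rel_entropy a t \<le> t - a + a * (a / t - 1)" by (simp add: rel_entropy_def)
  also have "\<dots> = (t - a)\<^sup>2 / t" using assms by (simp add: field_simps power2_eq_square)
  finally show ?thesis .
qed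

lemma rel_entropy_sublevel_bounded:
  assumes "a > 0"
  obtains lo hi where "lo > 0"
    "\<And>t. t > 0 \<Longrightarrow> rel_entropy a t \<le> K \<Longrightarrow> lo \<le> t \<and> t \<le> hi"
proof
  show "a * exp (- (K + a) / a) > 0" using assms by simp
  fix t :: real assume t: "t > 0" "rel_entropy a t \<le> K"
  have "- (K + a) \<le> a * ln (t / a)" using t assms by (simp add: rel_entropy_def)
  then have "- (K + a) / a \<le> ln (t / a)" using assms by (simp add: field_simps)
  then have "exp (- (K + a) / a) \<le> t / a" using assms t by (simp add: ln_ge_iff)
  moreover have "sqrt t \<le> sqrt a + sqrt K"
  proof -
    have "\<bar>sqrt t - sqrt a\<bar> \<le> sqrt K"
      using rel_entropy_ge[OF assms t(1)] t(2) by (intro real_le_rsqrt) auto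
    then show ?thesis by linarith
  qed
  then have "t \<le> (sqrt a + sqrt K)\<^sup>2" by (rule sqrt_le_D)
  ultimately show "a * exp (- (K + a) / a) \<le> t \<and> t \<le> (sqrt a + sqrt K)\<^sup>2"
    using assms by (simp add: field_simps)
qed

section \<open>Convergence by a Lyapunov function\<close>

text \<open>
  If \<open>L\<close> stayed above some \<open>\<epsilon> > 0\<close>, then \<open>V\<close> would decrease at least linearly and violate its
  lower bound; monotonicity turns one small value of \<open>L\<close> into smallness from then on. Keeping
  \<open>V\<close> and \<open>L\<close> apart allows \<open>V\<close> to be a perturbation of \<open>L\<close> that need not be nonnegative.
\<close>

lemma dissipated_quantity_tendsto_0:
  fixes L V :: "real \<Rightarrow> real"
  assumes "c > 0"
    and nonneg: "\<And>s. s \<ge> S \<Longrightarrow> L s \<ge> 0"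
    and decr: "\<And>s t. S \<le> s \<Longrightarrow> s \<le> t \<Longrightarrow> L t \<le> L s"
    and V: "\<And>s. s \<ge> S \<Longrightarrow> (V has_real_derivative V' s) (at s)"
    and diss: "\<And>s. s \<ge> S \<Longrightarrow> V' s \<le> - c * L s"
    and bdd: "\<And>s. s \<ge> S \<Longrightarrow> V s \<ge> B"
  shows "(L \<longlongrightarrow> 0) at_top"
proof (rule tendstoI)
  fix \<epsilon> :: real assume "\<epsilon> > 0"
  have "\<exists>s\<ge>S. L s < \<epsilon>"
  proof (rule ccontr)
    assume "\<not> (\<exists>s\<ge>S. L s < \<epsilon>)"
    then have big: "L s \<ge> \<epsilon>" if "s \<ge> S" for s using that by (simp add: not_less)
    define T where "T = S + (V S - B) / (c * \<epsilon>) + 1"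
    have "(V S - B) / (c * \<epsilon>) \<ge> 0" using bdd[of S] assms(1) \<open>\<epsilon> > 0\<close> by simp
    then have "S < T" by (simp add: T_def)
    then obtain z where z: "S < z" "V T - V S = (T - S) * V' z"
      using MVT2[of S T V V'] V by auto
    have "c * \<epsilon> \<le> c * L z" using big[of z] z(1) assms(1) by simp
    then have "V' z \<le> - (c * \<epsilon>)" using diss[of z] z(1) by simp
    then have "V T - V S \<le> (T - S) * - (c * \<epsilon>)"
      unfolding z(2) using \<open>S < T\<close> by (intro mult_left_mono) auto
    also have "\<dots> = - (V S - B) - c * \<epsilon>"
      using assms(1) \<open>\<epsilon> > 0\<close> by (simp add: T_def field_simps)
    finally have "V T \<le> B - c * \<epsilon>" by simp
    moreover have "c * \<epsilon> > 0" using assms(1) \<open>\<epsilon> > 0\<close> by simp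
    ultimately show False using bdd[of T] \<open>S < T\<close> by simp
  qed
  then obtain s where s: "s \<ge> S" "L s < \<epsilon>" by blast
  have "dist (L t) 0 < \<epsilon>" if "t \<ge> s" for t
    using decr[OF s(1) that] nonneg[of t] s that by simp
  then show "eventually (\<lambda>t. dist (L t) 0 < \<epsilon>) at_top"
    by (auto simp: eventually_at_top_linorder)
qed

text \<open>
  After division by \<open>x\<close> and \<open>w\<close>, the part of the system without \<open>(x - x\<^sub>0) (m x + G)\<close> is the
  Lotka--Volterra system in \<open>ln x\<close> and \<open>ln w\<close>, which conserves
  \<open>L = k H(x\<^sub>0, x) + \<beta> H(w\<^sub>0, w)\<close> with \<open>H\<close> the relative entropy. With the damping,
  \<open>L' = - k (x - x\<^sub>0)\<^sup>2 (m + G / x)\<close>. Hence the orbit stays in a compact subset of the open quadrant.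
  This dissipation does not see \<open>w\<close>; the cross term \<open>C = (x - x\<^sub>0) (w - w\<^sub>0)\<close> does, because its
  derivative contains \<open>- \<beta> x (w - w\<^sub>0)\<^sup>2\<close>. A large multiple of \<open>L\<close> plus \<open>C\<close> therefore dissipates both
  squared distances, which on the compact set dominate \<open>L\<close>.
\<close>

lemma damped_lotka_volterra_converges:
  fixes x w :: "real \<Rightarrow> real"
  assumes params: "k > 0" "\<beta> > 0" "m > 0" "G \<ge> 0" "x\<^sub>0 > 0" "w\<^sub>0 > 0"
    and x_pos: "\<And>s. s \<ge> S \<Longrightarrow> x s > 0"
    and w_pos: "\<And>s. s \<ge> S \<Longrightarrow> w s > 0"
    and x_deriv: "\<And>s. s \<ge> S \<Longrightarrow> (x has_real_derivative
          - (x s - x\<^sub>0) * (m * x s + G) - \<beta> * x s * (w s - w\<^sub>0)) (at s)"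
    and w_deriv: "\<And>s. s \<ge> S \<Longrightarrow> (w has_real_derivative k * (x s - x\<^sub>0) * w s) (at s)"
  shows "(w \<longlongrightarrow> w\<^sub>0) at_top"
proof -
  define e where "e s = x s - x\<^sub>0" for s
  define d where "d s = w s - w\<^sub>0" for s
  define L where "L s = k * rel_entropy x\<^sub>0 (x s) + \<beta> * rel_entropy w\<^sub>0 (w s)" for s
  define C where "C s = e s * d s" for s
  have ent: "rel_entropy x\<^sub>0 (x s) \<ge> 0" "rel_entropy w\<^sub>0 (w s) \<ge> 0" if "s \<ge> S" for s
    using rel_entropy_nonneg params x_pos[OF that] w_pos[OF that] by auto
  have L_deriv: "(L has_real_derivative - k * (e s)\<^sup>2 * (m + G / x s)) (at s)" if "s \<ge> S" for s
  proof -
    note X = DERIV_chain2[OF rel_entropy_has_derivative[OF params(5) x_pos[OF that]]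
        x_deriv[OF that]]
    note W = DERIV_chain2[OF rel_entropy_has_derivative[OF params(6) w_pos[OF that]]
        w_deriv[OF that]]
    have "k * ((1 - x\<^sub>0 / x s) * (- (x s - x\<^sub>0) * (m * x s + G) - \<beta> * x s * (w s - w\<^sub>0)))
        + \<beta> * ((1 - w\<^sub>0 / w s) * (k * (x s - x\<^sub>0) * w s)) = - k * (e s)\<^sup>2 * (m + G / x s)"
      using x_pos[OF that] w_pos[OF that]
      by (simp add: e_def field_simps power2_eq_square)
    then show ?thesis
      unfolding L_def[abs_def]
      using DERIV_add[OF DERIV_cmult[OF X, of k] DERIV_cmult[OF W, of \<beta>]] by simp
  qed
  have L_slope: "- k * (e s)\<^sup>2 * (m + G / x s) \<le> - (k * m) * (e s)\<^sup>2" if "s \<ge> S" for s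
    using params x_pos[OF that] by (simp add: algebra_simps)
  have L_decr: "L t \<le> L s" if "S \<le> s" "s \<le> t" for s t
  proof (rule DERIV_nonpos_imp_nonincreasing[OF that(2)])
    fix r assume "s \<le> r" "r \<le> t"
    then have "r \<ge> S" using that(1) by simp
    have "- (k * m) * (e r)\<^sup>2 \<le> 0" using params by simp
    with L_slope[OF \<open>r \<ge> S\<close>] have "- k * (e r)\<^sup>2 * (m + G / x r) \<le> 0" by (rule order_trans)
    then show "\<exists>y. (L has_real_derivative y) (at r) \<and> y \<le> 0"
      using L_deriv[OF \<open>r \<ge> S\<close>] by blast
  qed
  have L_nonneg: "L s \<ge> 0" if "s \<ge> S" for s
    using ent[OF that] params by (simp add: L_def)
  have "rel_entropy x\<^sub>0 (x s) \<le> L S / k" "rel_entropy w\<^sub>0 (w s) \<le> L S / \<beta>" if "s \<ge> S" for s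
  proof -
    have "k * rel_entropy x\<^sub>0 (x s) \<le> L S" "\<beta> * rel_entropy w\<^sub>0 (w s) \<le> L S"
      using L_decr[OF order.refl that] ent[OF that] params
        mult_nonneg_nonneg[of k "rel_entropy x\<^sub>0 (x s)"]
        mult_nonneg_nonneg[of \<beta> "rel_entropy w\<^sub>0 (w s)"]
      unfolding L_def[of s] by linarith+
    then show "rel_entropy x\<^sub>0 (x s) \<le> L S / k" "rel_entropy w\<^sub>0 (w s) \<le> L S / \<beta>"
      using params by (simp_all add: field_simps)
  qed
  note L_bounds = this
  obtain xl xh where x_bnd: "xl > 0"
    "\<And>t. t > 0 \<Longrightarrow> rel_entropy x\<^sub>0 t \<le> L S / k \<Longrightarrow> xl \<le> t \<and> t \<le> xh"
    using rel_entropy_sublevel_bounded[OF params(5)] by blast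
  obtain wl wh where w_bnd: "wl > 0"
    "\<And>t. t > 0 \<Longrightarrow> rel_entropy w\<^sub>0 t \<le> L S / \<beta> \<Longrightarrow> wl \<le> t \<and> t \<le> wh"
    using rel_entropy_sublevel_bounded[OF params(6)] by blast
  note lpos = x_bnd(1) w_bnd(1)
  \<comment> \<open>The orbit stays in \<open>[xl, xh] \<times> [wl, wh]\<close>.\<close>
  have bnd: "xl \<le> x s" "x s \<le> xh" "wl \<le> w s" "w s \<le> wh" if "s \<ge> S" for s
    using x_bnd(2)[OF x_pos[OF that]] w_bnd(2)[OF w_pos[OF that]] L_bounds[OF that] by auto
  \<comment> \<open>\<open>q\<close> is half of the dissipation rate of \<open>(w - w\<^sub>0)\<^sup>2\<close> through \<open>C\<close>: the other half absorbs the
    mixed term of size \<open>M |e| |d|\<close>. \<open>K\<close> is the resulting growth rate in \<open>(x - x\<^sub>0)\<^sup>2\<close>, for which \<open>N\<close>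
    copies of \<open>L\<close> compensate, and \<open>R\<close> compares \<open>L\<close> with the squared distances.\<close>
  define M where "M = m * xh + G"
  define q where "q = \<beta> * xl / 2"
  define K where "K = k * wh + M\<^sup>2 / (4 * q)"
  define N where "N = (\<bar>K\<bar> + 1) / (k * m)"
  define R where "R = k / xl + \<beta> / (wl * q)"
  define V where "V s = N * L s + C s" for s
  have "q > 0" using params lpos by (simp add: q_def)
  have "N > 0" using params by (simp add: N_def)
  have "R > 0" using params lpos \<open>q > 0\<close> by (simp add: R_def add_pos_pos)
  define C' where "C' s = - e s * (m * x s + G) * d s - \<beta> * x s * (d s)\<^sup>2
      + k * w s * (e s)\<^sup>2" for s
  have C_deriv: "(C has_real_derivative C' s) (at s)" if "s \<ge> S" for s
    unfolding C_def[abs_def] C'_def e_def d_def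
    by (rule derivative_eq_intros x_deriv w_deriv that refl)+
      (simp add: algebra_simps power2_eq_square)
  have C_slope: "C' s \<le> K * (e s)\<^sup>2 - q * (d s)\<^sup>2" if "s \<ge> S" for s
  proof -
    have "\<bar>m * x s + G\<bar> \<le> M"
      using bnd(2)[OF that] x_pos[OF that] params by (simp add: M_def)
    then have "\<bar>m * x s + G\<bar> * \<bar>e s * d s\<bar> \<le> M * \<bar>e s * d s\<bar>" by (intro mult_right_mono) auto
    then have "- e s * (m * x s + G) * d s \<le> M * (\<bar>e s\<bar> * \<bar>d s\<bar>)"
      by (simp add: abs_mult[symmetric] mult_ac)
    moreover have "M * (\<bar>e s\<bar> * \<bar>d s\<bar>) \<le> M\<^sup>2 / (4 * q) * (e s)\<^sup>2 + q * (d s)\<^sup>2"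
    proof -
      have "0 \<le> (M * \<bar>e s\<bar> - 2 * q * \<bar>d s\<bar>)\<^sup>2 / (4 * q)" using \<open>q > 0\<close> by simp
      also have "\<dots> = M\<^sup>2 / (4 * q) * (e s)\<^sup>2 + q * (d s)\<^sup>2 - M * (\<bar>e s\<bar> * \<bar>d s\<bar>)"
        using \<open>q > 0\<close> by (simp add: power2_diff power_mult_distrib field_simps power2_eq_square)
      finally show ?thesis by simp
    qed
    moreover have "\<beta> * x s * (d s)\<^sup>2 \<ge> 2 * q * (d s)\<^sup>2"
      using bnd(1)[OF that] params by (intro mult_right_mono) (auto simp: q_def)
    moreover have "k * w s * (e s)\<^sup>2 \<le> k * wh * (e s)\<^sup>2"
      using bnd(4)[OF that] params by (intro mult_right_mono) auto
    ultimately show ?thesis unfolding C'_def K_def by (simp add: algebra_simps)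
  qed
  have L_le: "L s \<le> R * ((e s)\<^sup>2 + q * (d s)\<^sup>2)" if "s \<ge> S" for s
  proof -
    have "rel_entropy x\<^sub>0 (x s) \<le> (e s)\<^sup>2 / xl"
      using rel_entropy_le[OF params(5) x_pos[OF that]] bnd(1)[OF that] lpos
        frac_le[of "(e s)\<^sup>2" "(e s)\<^sup>2" xl "x s"] by (simp add: e_def)
    moreover have "rel_entropy w\<^sub>0 (w s) \<le> (d s)\<^sup>2 / wl"
      using rel_entropy_le[OF params(6) w_pos[OF that]] bnd(3)[OF that] lpos
        frac_le[of "(d s)\<^sup>2" "(d s)\<^sup>2" wl "w s"] by (simp add: d_def)
    ultimately have "L s \<le> k * ((e s)\<^sup>2 / xl) + \<beta> * ((d s)\<^sup>2 / wl)"
      unfolding L_def using params by (intro add_mono mult_left_mono) auto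
    also have "\<dots> = k / xl * (e s)\<^sup>2 + \<beta> / (wl * q) * (q * (d s)\<^sup>2)"
      using lpos \<open>q > 0\<close> by simp
    also have "\<dots> \<le> R * (e s)\<^sup>2 + R * (q * (d s)\<^sup>2)"
      unfolding R_def using params lpos \<open>q > 0\<close>
      by (intro add_mono mult_right_mono) auto
    finally show ?thesis by (simp add: distrib_left)
  qed
  have "(L \<longlongrightarrow> 0) at_top"
  proof (rule dissipated_quantity_tendsto_0)
    show "1 / R > 0" using \<open>R > 0\<close> by simp
    fix s assume s: "s \<ge> S"
    show "(V has_real_derivative N * (- k * (e s)\<^sup>2 * (m + G / x s)) + C' s) (at s)"
      unfolding V_def[abs_def] by (intro DERIV_add DERIV_cmult L_deriv C_deriv s)
    have "N * (- k * (e s)\<^sup>2 * (m + G / x s)) \<le> N * (- (k * m) * (e s)\<^sup>2)"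
      using L_slope[OF s] \<open>N > 0\<close> by (intro mult_left_mono) auto
    also have "\<dots> = - (N * (k * m)) * (e s)\<^sup>2" by (simp add: mult_ac)
    also have "N * (k * m) = \<bar>K\<bar> + 1" using params by (simp add: N_def)
    also have "- (\<bar>K\<bar> + 1) * (e s)\<^sup>2 \<le> - (K + 1) * (e s)\<^sup>2" by (intro mult_right_mono) auto
    finally have "N * (- k * (e s)\<^sup>2 * (m + G / x s)) + C' s \<le> - ((e s)\<^sup>2 + q * (d s)\<^sup>2)"
      using C_slope[OF s] by (simp add: algebra_simps)
    also have "\<dots> \<le> - (1 / R) * L s" using L_le[OF s] \<open>R > 0\<close> by (simp add: field_simps)
    finally show "N * (- k * (e s)\<^sup>2 * (m + G / x s)) + C' s \<le> - (1 / R) * L s" .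
    have "\<bar>e s\<bar> \<le> xh + x\<^sub>0" "\<bar>d s\<bar> \<le> wh + w\<^sub>0"
      using bnd[OF s] x_pos[OF s] w_pos[OF s] params by (auto simp: e_def d_def)
    then have "\<bar>e s\<bar> * \<bar>d s\<bar> \<le> (xh + x\<^sub>0) * (wh + w\<^sub>0)" by (intro mult_mono) auto
    moreover have "- (\<bar>e s\<bar> * \<bar>d s\<bar>) \<le> C s" by (simp add: C_def flip: abs_mult)
    moreover have "N * L s \<ge> 0" using L_nonneg[OF s] \<open>N > 0\<close> by simp
    ultimately show "V s \<ge> - ((xh + x\<^sub>0) * (wh + w\<^sub>0))" by (simp add: V_def)
  qed (use L_nonneg L_decr in auto)
  then have "((\<lambda>s. L s / \<beta>) \<longlongrightarrow> 0) at_top" by (rule tendsto_divide_zero)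
  moreover have "eventually (\<lambda>s. norm ((sqrt (w s) - sqrt w\<^sub>0)\<^sup>2) \<le> L s / \<beta>) at_top"
    using eventually_ge_at_top[of S]
  proof eventually_elim
    case (elim s)
    have "rel_entropy w\<^sub>0 (w s) \<le> L s / \<beta>"
      using ent[OF elim] params by (simp add: L_def field_simps)
    then show ?case using rel_entropy_ge[OF params(6) w_pos[OF elim]] by simp
  qed
  ultimately have "((\<lambda>s. (sqrt (w s) - sqrt w\<^sub>0)\<^sup>2) \<longlongrightarrow> 0) at_top"
    by (rule Lim_null_comparison[rotated])
  then have "((\<lambda>s. (sqrt (w s) - sqrt w\<^sub>0)) \<longlongrightarrow> 0) at_top"
    by (auto dest!: tendsto_real_sqrt simp: tendsto_rabs_zero_iff)
  then have "((\<lambda>s. (sqrt (w s) - sqrt w\<^sub>0 + sqrt w\<^sub>0)\<^sup>2) \<longlongrightarrow> (0 + sqrt w\<^sub>0)\<^sup>2) at_top"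
    by (intro tendsto_intros)
  moreover have "eventually (\<lambda>s. (sqrt (w s) - sqrt w\<^sub>0 + sqrt w\<^sub>0)\<^sup>2 = w s) at_top"
    using eventually_ge_at_top[of S] by eventually_elim (use w_pos in \<open>simp add: less_imp_le\<close>)
  ultimately have "(w \<longlongrightarrow> (0 + sqrt w\<^sub>0)\<^sup>2) at_top" by (rule Lim_transform_eventually)
  then show ?thesis using params by simp
qed

section \<open>Decay at infinity\<close>

theorem theorem1p3:
  fixes n :: nat and m \<rho>\<^sub>1 \<eta> \<alpha> \<beta> :: real and f :: "real \<Rightarrow> real"
  assumes "n = CARD('n::finite)" and "n \<ge> 3"
    and "0 < m" and "m < (real n - 2) / real n"
    and "\<rho>\<^sub>1 > 0" and "\<eta> > 0"
    and "\<beta> > m * \<rho>\<^sub>1 / (real n - 2 - real n * m)"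
    and "\<alpha> = (2 * \<beta> + \<rho>\<^sub>1) / (1 - m)"
    and "C2_on f {0<..}"
    and "\<And>x :: real ^ 'n. x \<noteq> 0 \<Longrightarrow>
           laplacian (\<lambda>y :: real ^ 'n. f (norm y) powr m / m) x + \<alpha> * f (norm x)
             + \<beta> * (x \<bullet> gradient (\<lambda>y :: real ^ 'n. f (norm y)) x) = 0"
    and "\<And>x :: real ^ 'n. x \<noteq> 0 \<Longrightarrow> f (norm x) > 0"
    and "((\<lambda>r. r powr (\<alpha> / \<beta>) * f r) \<longlongrightarrow> \<eta>) (at_right 0)"
  shows "((\<lambda>x :: real ^ 'n. (norm x)\<^sup>2 * f (norm x) powr (1 - m)) \<longlongrightarrow>
           2 * (real n - 2 - real n * m) / ((1 - m) * \<rho>\<^sub>1)) at_infinity"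
proof -
  define N where "N = real n"
  define \<kappa> where "\<kappa> = \<alpha> / \<beta>"
  define \<gamma> where "\<gamma> = \<kappa> * (N - 2 - m * \<kappa>)"
  define e where "e = N - 2 - 2 * m * \<kappa>"
  define x\<^sub>0 where "x\<^sub>0 = \<rho>\<^sub>1 / ((1 - m) * \<beta>)"
  define w\<^sub>0 where "w\<^sub>0 = 2 * (N - 2 - N * m) / ((1 - m) * \<rho>\<^sub>1)"
  have N: "N \<ge> 3" using assms(2) by (simp add: N_def)
  have b: "N - 2 - N * m > 0" using assms(4) N by (simp add: N_def field_simps)
  have "N * m < N * 1" using b by simp
  then have "m < 1" using N by simp
  have "m * \<rho>\<^sub>1 / (N - 2 - N * m) > 0" using assms(3,5) b by simp
  then have "\<beta> > 0" using assms(7) by (simp add: N_def)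
  have \<beta>_large: "m * \<rho>\<^sub>1 < \<beta> * (N - 2 - N * m)"
    using assms(7) b by (simp add: N_def pos_divide_less_eq)
  have \<kappa>: "\<kappa> = (2 + \<rho>\<^sub>1 / \<beta>) / (1 - m)"
    using \<open>\<beta> > 0\<close> by (simp add: \<kappa>_def assms(8) add_divide_distrib)
  have "\<kappa> > 0" using \<open>\<beta> > 0\<close> \<open>m < 1\<close> assms(5) by (simp add: \<kappa> add_pos_pos)
  have "m * (\<rho>\<^sub>1 / \<beta>) < N - 2 - N * m" using \<beta>_large \<open>\<beta> > 0\<close> by (simp add: field_simps)
  then have "m * \<kappa> < N - 2" using \<open>m < 1\<close> by (simp add: \<kappa> field_simps)
  \<comment> \<open>The sign of \<open>\<gamma>\<close> is where the lower bound on \<open>\<beta>\<close> enters.\<close>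
  then have "\<gamma> > 0" using \<open>\<kappa> > 0\<close> by (simp add: \<gamma>_def)
  have "x\<^sub>0 > 0" using assms(5) \<open>m < 1\<close> \<open>\<beta> > 0\<close> by (simp add: x\<^sub>0_def)
  have "w\<^sub>0 > 0" using assms(5) \<open>m < 1\<close> b by (simp add: w\<^sub>0_def)
  have x\<^sub>0: "(1 - m) * (\<kappa> - x\<^sub>0) = 2"
  proof -
    have "(1 - m) * \<kappa> = 2 + \<rho>\<^sub>1 / \<beta>" "(1 - m) * x\<^sub>0 = \<rho>\<^sub>1 / \<beta>"
      using \<open>m < 1\<close> by (simp_all add: \<kappa> x\<^sub>0_def)
    then show ?thesis by (simp add: right_diff_distrib)
  qed
  \<comment> \<open>\<open>(x\<^sub>0, w\<^sub>0)\<close> is the equilibrium of the planar system.\<close>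
  have equilibrium: "\<gamma> = x\<^sub>0 * (m * x\<^sub>0 + e + \<beta> * w\<^sub>0)"
  proof -
    have \<kappa>': "\<kappa> = x\<^sub>0 + 2 / (1 - m)" using x\<^sub>0 \<open>m < 1\<close> by (simp add: field_simps)
    have "\<beta> * w\<^sub>0 * x\<^sub>0 = 2 * (N - 2 - N * m) / (1 - m)\<^sup>2"
      using \<open>m < 1\<close> \<open>\<beta> > 0\<close> assms(5) by (simp add: w\<^sub>0_def x\<^sub>0_def power2_eq_square)
    moreover have "\<gamma> - x\<^sub>0 * (m * x\<^sub>0 + e) = 2 * (N - 2 - N * m) / (1 - m)\<^sup>2"
    proof -
      define c where "c = 2 / (1 - m)"
      have "m * c = c - 2" using \<open>m < 1\<close> by (simp add: c_def field_simps)
      have "\<gamma> - x\<^sub>0 * (m * x\<^sub>0 + e) = c * (N - 2 - m * c)"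
        unfolding \<gamma>_def e_def \<kappa>' c_def[symmetric] by (simp add: algebra_simps)
      also have "\<dots> = c * (N - c)" unfolding \<open>m * c = c - 2\<close> by simp
      also have "N - c = (N - 2 - N * m) / (1 - m)"
        using \<open>m < 1\<close> by (simp add: c_def field_simps)
      finally show ?thesis by (simp add: c_def power2_eq_square)
    qed
    ultimately show ?thesis by (simp add: algebra_simps)
  qed

  have pos: "f r > 0" if "r > 0" for r
  proof -
    have "r \<ge> 0" using that by simp
    then obtain x :: "real ^ 'n" where "norm x = r" by (rule vector_choose_size)
    then show ?thesis using assms(11)[of x] that by auto
  qed
  have f: "(f has_real_derivative deriv f r) (at r)"
    and f': "(deriv f has_real_derivative deriv (deriv f) r) (at r)" if "r > 0" for r
    using assms(9) that by (auto simp: C2_on_def DERIV_deriv_iff_real_differentiable)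
  have ode: "(m - 1) * f r powr (m - 2) * (deriv f r)\<^sup>2 + f r powr (m - 1) * deriv (deriv f) r
      + (N - 1) / r * (f r powr (m - 1) * deriv f r) + \<alpha> * f r + \<beta> * (r * deriv f r) = 0"
    if "r > 0" for r
    using radial_profile_equation[OF assms(3) that f f' pos assms(10)]
    by (simp add: N_def assms(1))

  define u where "u s = ln (f (exp s)) + \<kappa> * s" for s
  define x where "x s = exp s * deriv f (exp s) / f (exp s) + \<kappa>" for s
  define w where "w s = (exp s)\<^sup>2 * f (exp s) powr (1 - m)" for s
  have "\<alpha> = \<beta> * \<kappa>" using \<open>\<beta> > 0\<close> by (simp add: \<kappa>_def)
  note log_vars = radial_equation_logarithmic_variables[OF f f' pos ode this,
      folded u_def x_def w_def]
  have u_deriv: "(u has_real_derivative x s) (at s)" for s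
    using log_vars(1) unfolding u_def[abs_def] x_def .
  have x_deriv: "(x has_real_derivative \<gamma> - (m * x s + e + \<beta> * w s) * x s) (at s)" for s
    using log_vars(2) unfolding x_def[abs_def] w_def \<gamma>_def e_def .
  have w_deriv: "(w has_real_derivative (1 - m) * (x s - x\<^sub>0) * w s) (at s)" for s
  proof -
    have "2 + (1 - m) * (x s - \<kappa>) = (1 - m) * (x s - x\<^sub>0)" using x\<^sub>0 by (simp add: algebra_simps)
    then show ?thesis using log_vars(3)[of s] unfolding w_def[abs_def] x_def by simp
  qed
  have w_pos: "w s > 0" for s using pos[of "exp s"] by (simp add: w_def)

  have exp_bot: "filterlim exp (at_right 0) (at_bot :: real filter)"
    using exp_at_bot by (simp add: filterlim_at)
  have "((\<lambda>s. ln (exp s powr \<kappa> * f (exp s))) \<longlongrightarrow> ln \<eta>) at_bot"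
    using filterlim_compose[OF assms(12) exp_bot] assms(6) by (intro tendsto_ln) (auto simp: \<kappa>_def)
  moreover have "ln (exp s powr \<kappa> * f (exp s)) = u s" for s
    using pos[of "exp s"] by (simp add: u_def ln_mult ln_powr)
  ultimately have u_lim: "(u \<longlongrightarrow> ln \<eta>) at_bot" by simp
  \<comment> \<open>Near the origin \<open>r\<^sup>2 f powr (1 - m)\<close> blows up like a negative power of \<open>r\<close>, as \<open>(1 - m) \<kappa> > 2\<close>.\<close>
  have w_exp: "w s = exp ((1 - m) * u s + (- (\<rho>\<^sub>1 / \<beta>)) * s)" for s
  proof -
    have "(1 - m) * \<kappa> - 2 = \<rho>\<^sub>1 / \<beta>" using \<open>m < 1\<close> by (simp add: \<kappa>)
    then have "(1 - m) * u s + (- (\<rho>\<^sub>1 / \<beta>)) * s = 2 * s + (1 - m) * ln (f (exp s))"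
      unfolding u_def by (simp add: algebra_simps flip: \<open>_ = \<rho>\<^sub>1 / \<beta>\<close>)
    then show ?thesis
      using pos[of "exp s"] by (simp add: w_def powr_def exp_add exp_double)
  qed
  have "filterlim (\<lambda>s. exp ((1 - m) * u s + (- (\<rho>\<^sub>1 / \<beta>)) * s)) at_top at_bot"
  proof (intro filterlim_compose[OF exp_at_top] filterlim_tendsto_add_at_top)
    show "((\<lambda>s. (1 - m) * u s) \<longlongrightarrow> (1 - m) * ln \<eta>) at_bot" by (intro tendsto_intros u_lim)
    show "filterlim (\<lambda>s. (- (\<rho>\<^sub>1 / \<beta>)) * s) at_top at_bot"
      using assms(5) \<open>\<beta> > 0\<close>
        filterlim_tendsto_pos_mult_at_top[OF tendsto_const _ filterlim_ident, of "\<rho>\<^sub>1 / \<beta>"]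
      by (simp add: filterlim_at_bot_mirror)
  qed
  then have w_top: "filterlim w at_top at_bot" by (simp only: w_exp[symmetric])

  obtain S where S: "\<And>s. s \<ge> S \<Longrightarrow> x s > 0"
    using log_slope_becomes_positive[OF \<open>\<gamma> > 0\<close> \<open>\<beta> > 0\<close> u_deriv x_deriv w_top u_lim] by blast
  have "(w \<longlongrightarrow> w\<^sub>0) at_top"
  proof (rule damped_lotka_volterra_converges)
    show "1 - m > 0" "\<gamma> / x\<^sub>0 \<ge> 0" using \<open>m < 1\<close> \<open>\<gamma> > 0\<close> \<open>x\<^sub>0 > 0\<close> by simp_all
    fix s
    have "\<gamma> / x\<^sub>0 = m * x\<^sub>0 + e + \<beta> * w\<^sub>0" using equilibrium \<open>x\<^sub>0 > 0\<close> by simp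
    then have "\<gamma> - (m * x s + e + \<beta> * w s) * x s
        = - (x s - x\<^sub>0) * (m * x s + \<gamma> / x\<^sub>0) - \<beta> * x s * (w s - w\<^sub>0)"
      unfolding equilibrium by (simp add: algebra_simps)
    then show "(x has_real_derivative
        - (x s - x\<^sub>0) * (m * x s + \<gamma> / x\<^sub>0) - \<beta> * x s * (w s - w\<^sub>0)) (at s)"
      using x_deriv[of s] by simp
  qed (use S w_pos w_deriv assms(3) \<open>\<beta> > 0\<close> \<open>x\<^sub>0 > 0\<close> \<open>w\<^sub>0 > 0\<close> in auto)
  moreover have "filterlim (\<lambda>x :: real ^ 'n. ln (norm x)) at_top at_infinity"
    by (rule filterlim_compose[OF ln_at_top filterlim_norm_at_top])
  ultimately have "((\<lambda>x :: real ^ 'n. w (ln (norm x))) \<longlongrightarrow> w\<^sub>0) at_infinity"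
    by (rule filterlim_compose)
  moreover have "eventually (\<lambda>x :: real ^ 'n.
      w (ln (norm x)) = (norm x)\<^sup>2 * f (norm x) powr (1 - m)) at_infinity"
  proof (rule eventually_at_infinityI)
    fix x :: "real ^ 'n"
    assume "1 \<le> norm x"
    then have "exp (ln (norm x)) = norm x" by (intro exp_ln) linarith
    then show "w (ln (norm x)) = (norm x)\<^sup>2 * f (norm x) powr (1 - m)" by (simp add: w_def)
  qed
  ultimately show ?thesis
    unfolding w\<^sub>0_def N_def by (rule Lim_transform_eventually)
qed

end
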